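(* Consider the $M$-user Aloha network described in the context, with arrival variables $A_i(n)$, transmission variables $W_i(n)$, $\lambda_i=\mathbb{E}A_i(n)$, $C_i=\mathbb{E}W_i(n)$, $p_i=\mathbb{P}(W_i(n)\ge 1)$, and queue-length Markov chain $\underline{Q}(n)=(Q_1(n),\ldots,Q_M(n))$. (a) If $W_i(n)\in\{0,1\}$ for all $n$ and all $1\le i\le M$, and $$\sum_{i=1}^{M}\frac{\lambda_i}{C_i\prod_{j\ne i}(1-p_j)}<1$$ (where all the denominators are nonzero), then $\{\underline{Q}(n)\}$ is positive recurrent. (b) If $\max_{1\le i\le M}\mathbb{E}A_i^4(1)<\infty$, $\max_{1\le i\le M}\mathbb{E}W_i^4(1)<\infty$ and $$\lambda_i> C_i\prod_{j\ne i}(1-p_j)\quad\text{for all }1\le i\le M,$$ then $\{\underline{Q}(n)\}$ is transient.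
   Context: Model. Let $M\ge 1$ be an integer (number of users). For each $1\le i\le M$: - $\{A_i(n)\}_{n\ge1}$ are i.i.d. nonnegative integer valued random variables (packets arriving at user $i$ in time slot $n$) with finite mean $\lambda_i=\mathbb{E}A_i(n)$ and $\mathbb{P}(A_i(n)=1)>0$. - $\{W_i(n)\}_{n\ge1}$ are i.i.d. nonnegative integer valued random variables with finite mean $C_i=\mathbb{E}W_i(n)$ and $\mathbb{P}(W_i(n)=1)>0$. Put $p_i:=\mathbb{P}(W_i(n)\ge1)$ (the attempt probability of user $i$). The $2M$ sequences $\{A_i(n)\}_{n\ge1}$, $\{W_i(n)\}_{n\ge1}$, $1\le i\le M$, are mutually independent, and independent of the initial state $\underline{Q}(0)$. The queue lengths $Q_i(n)\in\{0,1,2,\ldots\}$ evolve for $n\ge0$ by $$Q_i(n+1)=Q_i(n)+A_i(n+1)-\min(Q_i(n),W_i(n+1))\,\mathbf{1}\Big(B_i(n+1)\cap\bigcap_{j\ne i}B_j^c(n+1)\Big),$$ where $B_i(n+1)=\{Q_i(n)\ge1\}\cap\{W_i(n+1)\ge1\}$, $B_j^c$ is the complement of $B_j$, and $\mathbf{1}(\cdot)$ is the indicator function. Thus $\underline{Q}(n)=(Q_1(n),\ldots,Q_M(n))$ is a time-homogeneous Markov chain on $\{0,1,2,\ldots\}^M$. Empty products equal $1$. Recurrence and transience of the chain are understood via the origin: with $\underline{Q}(0)=(0,\ldots,0)$ and $T=\inf\{k\ge1: Q_i(k)=0\text{ for all }1\le i\le M\}$ (with $\inf\emptyset=\infty$),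 the chain is positive recurrent if $\mathbb{E}T<\infty$ and transient if $\mathbb{P}(T=\infty)>0$. *)

theory Defs
  imports "HOL-Probability.Probability"
begin

(* Users are 1..M and time slots are n >= 1; the values of A and W at other indices are irrelevant.
   Joint independence of the whole family (A_i(n), W_i(n))_(i,n) expresses both the independence
   within each of the 2M sequences and the mutual independence of these sequences.
   indep_vars also makes each A_i(n) and W_i(n) measurable. *)
locale aloha_network = prob_space P
  for P :: "'w measure" +
  fixes M :: nat
    and A W :: "nat \<Rightarrow> nat \<Rightarrow> 'w \<Rightarrow> nat"
  assumes M_ge_1: "M \<ge> 1"
    and indep: "indep_vars (\<lambda>_. count_space UNIV) (\<lambda>(k, n). case k of Inl i \<Rightarrow> A i n | Inr i \<Rightarrow> W i n)
                  (({1..M} <+> {1..M}) \<times> {1..})"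
    and A_ident: "\<And>i n. i \<in> {1..M} \<Longrightarrow> n \<ge> 1 \<Longrightarrow>
                  distr P (count_space UNIV) (A i n) = distr P (count_space UNIV) (A i 1)"
    and W_ident: "\<And>i n. i \<in> {1..M} \<Longrightarrow> n \<ge> 1 \<Longrightarrow>
                  distr P (count_space UNIV) (W i n) = distr P (count_space UNIV) (W i 1)"
    and A_integrable: "\<And>i. i \<in> {1..M} \<Longrightarrow> integrable P (\<lambda>\<omega>. real (A i 1 \<omega>))"
    and W_integrable: "\<And>i. i \<in> {1..M} \<Longrightarrow> integrable P (\<lambda>\<omega>. real (W i 1 \<omega>))"
    and A_one_pos: "\<And>i. i \<in> {1..M} \<Longrightarrow> \<P>(\<omega> in P. A i 1 \<omega> = 1) > 0"
    and W_one_pos: "\<And>i. i \<in> {1..M} \<Longrightarrow> \<P>(\<omega> in P. W i 1 \<omega> = 1) > 0"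

(* User j attempts a transmission when the queue lengths are Q and the transmission variables of
   the slot are w; this is the event B_j. *)
definition attempts :: "(nat \<Rightarrow> nat) \<Rightarrow> (nat \<Rightarrow> nat) \<Rightarrow> nat \<Rightarrow> bool" where
  "attempts Q w j \<longleftrightarrow> Q j \<ge> 1 \<and> w j \<ge> 1"

(* The subtraction on nat never truncates, since min (Q i) (w i) \<le> Q i. *)
definition aloha_step :: "nat \<Rightarrow> (nat \<Rightarrow> nat) \<Rightarrow> (nat \<Rightarrow> nat) \<Rightarrow> (nat \<Rightarrow> nat) \<Rightarrow> nat \<Rightarrow> nat" where
  "aloha_step M a w Q i =
     Q i + a i - min (Q i) (w i) * of_bool (attempts Q w i \<and> (\<forall>j\<in>{1..M} - {i}. \<not> attempts Q w j))"

(* The queue length vector at time n, started from q. *)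
primrec aloha_queue ::
  "nat \<Rightarrow> (nat \<Rightarrow> nat \<Rightarrow> 'w \<Rightarrow> nat) \<Rightarrow> (nat \<Rightarrow> nat \<Rightarrow> 'w \<Rightarrow> nat) \<Rightarrow> (nat \<Rightarrow> nat) \<Rightarrow> nat \<Rightarrow> 'w \<Rightarrow> nat \<Rightarrow> nat"
where
  "aloha_queue M A W q 0 \<omega> = q"
| "aloha_queue M A W q (Suc n) \<omega> =
     aloha_step M (\<lambda>i. A i (Suc n) \<omega>) (\<lambda>i. W i (Suc n) \<omega>) (aloha_queue M A W q n \<omega>)"

(* Return time to the origin when started at the origin; the infimum of the empty set is \<infinity> in enat. *)
definition aloha_return_time ::
  "nat \<Rightarrow> (nat \<Rightarrow> nat \<Rightarrow> 'w \<Rightarrow> nat) \<Rightarrow> (nat \<Rightarrow> nat \<Rightarrow> 'w \<Rightarrow> nat) \<Rightarrow> 'w \<Rightarrow> enat" where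
  "aloha_return_time M A W \<omega> =
     Inf {enat k | k. k \<ge> 1 \<and> (\<forall>i\<in>{1..M}. aloha_queue M A W (\<lambda>_. 0) k \<omega> i = 0)}"

definition aloha_positive_recurrent ::
  "'w measure \<Rightarrow> nat \<Rightarrow> (nat \<Rightarrow> nat \<Rightarrow> 'w \<Rightarrow> nat) \<Rightarrow> (nat \<Rightarrow> nat \<Rightarrow> 'w \<Rightarrow> nat) \<Rightarrow> bool" where
  "aloha_positive_recurrent P M A W \<longleftrightarrow>
     (\<integral>\<^sup>+\<omega>. ennreal_of_enat (aloha_return_time M A W \<omega>) \<partial>P) < \<infinity>"

definition aloha_transient ::
  "'w measure \<Rightarrow> nat \<Rightarrow> (nat \<Rightarrow> nat \<Rightarrow> 'w \<Rightarrow> nat) \<Rightarrow> (nat \<Rightarrow> nat \<Rightarrow> 'w \<Rightarrow> nat) \<Rightarrow> bool" where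
  "aloha_transient P M A W \<longleftrightarrow> \<P>(\<omega> in P. aloha_return_time M A W \<omega> = \<infinity>) > 0"

end

theory Submission
  imports Defs
begin

text \<open>
  The quantity that governs both parts is the saturated service of user \<open>i\<close> in a slot: the value of
  \<open>W\<^sub>i\<close> if nobody else has a positive transmission variable, and \<open>0\<close> otherwise. This is what user \<open>i\<close>
  would get if all queues were nonempty and its own were long, and by independence it has mean
  \<open>C\<^sub>i * (\<Prod>j\<noteq>i. 1 - p\<^sub>j)\<close> (lemma \<open>expectation_solo\<close>). In the true network two things differ. Empty
  queues of other users cannot collide, which only increases the service of \<open>i\<close>; and a short queue of \<open>i\<close>
  cannot use all of \<open>W\<^sub>i\<close>, which only decreases it.

  For part (a) the second effect is absent, since \<open>W\<^sub>i\<close> is at most \<open>1\<close>. So a nonempty queue is served at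
  least at the saturated rate, and the Lyapunov function \<open>\<Sum>i. q\<^sub>i / (C\<^sub>i * (\<Prod>j\<noteq>i. 1 - p\<^sub>j))\<close> decreases by at
  least \<open>1\<close> in mean for each nonempty queue, while arrivals add the load, which is less than \<open>1\<close>. Hence at
  every state other than the origin the drift is at most some \<open>-\<epsilon> < 0\<close> (lemma \<open>drain_time_drift\<close>), and
  summing this along the path up to the return time gives
  \<open>\<epsilon> * (\<Sum>n\<ge>1. \<P>(T > n)) \<le> \<close> (mean of the function at time \<open>1\<close>) \<open>< \<infinity>\<close>; this is lemma \<open>positive_recurrence\<close>.

  For part (b) the first effect is absent as long as no queue is empty. During that time \<open>Q\<^sub>i\<close> stays above the
  random walk with i.i.d. steps "arrivals minus saturated service", which have positive mean by assumption.
  If every walk is positive at all times \<open>n \<ge> 1\<close>, then no queue is empty at any time \<open>n \<ge> 1\<close>, and the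
  chain does not return (lemma \<open>queue_ge_net_gain\<close>). With positive probability all walks go up in each of the first \<open>K\<close>
  slots, and independently of that the walk of user \<open>i\<close> later loses \<open>K\<close> or more with probability at most
  \<open>\<Sum>n. c\<^sub>i / (n + K)\<^sup>2\<close>, by a fourth moment estimate (lemma \<open>indep_sum_left_tail\<close>). For large \<open>K\<close> the sum of
  these bounds over \<open>i\<close> is less than \<open>1\<close>, so survival has positive probability (lemma \<open>transience\<close>).
\<close>

section \<open>Fourth moments of sums of independent variables\<close>

lemma abs_power_le_one_plus_fourth:
  fixes x :: real
  assumes "k \<le> 4"
  shows "\<bar>x ^ k\<bar> \<le> 1 + x ^ 4"
proof (cases "\<bar>x\<bar> \<le> 1")
  case True
  then have "\<bar>x\<bar> ^ k \<le> 1" by (simp add: power_le_one)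
  then show ?thesis by (simp add: power_abs add_increasing2)
next
  case False
  then have "\<bar>x\<bar> ^ k \<le> \<bar>x\<bar> ^ 4" using assms by (intro power_increasing) auto
  also have "\<bar>x\<bar> ^ 4 = x ^ 4" by (simp add: power_abs[symmetric])
  finally show ?thesis by (simp add: power_abs)
qed

lemma fourth_power_sum_le:
  fixes x y :: real
  shows "(x + y) ^ 4 \<le> 8 * (x ^ 4 + y ^ 4)"
proof -
  have sq: "(a + b) ^ 2 \<le> 2 * (a ^ 2 + b ^ 2)" for a b :: real
    using zero_le_power2[of "a - b"] by (simp add: power2_eq_square algebra_simps)
  have "((x + y) ^ 2) ^ 2 \<le> (2 * (x ^ 2 + y ^ 2)) ^ 2" using sq by (intro power_mono) auto
  also have "\<dots> = 4 * (x ^ 2 + y ^ 2) ^ 2" by (subst power_mult_distrib) simp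
  also have "\<dots> \<le> 4 * (2 * ((x ^ 2) ^ 2 + (y ^ 2) ^ 2))" by (intro mult_left_mono sq) auto
  finally show ?thesis by (simp flip: power_mult)
qed

context prob_space
begin

lemma integrable_power_of_fourth:
  fixes X :: "'a \<Rightarrow> real"
  assumes [measurable]: "X \<in> borel_measurable M" and "integrable M (\<lambda>x. X x ^ 4)" and "k \<le> 4"
  shows "integrable M (\<lambda>x. X x ^ k)"
proof (rule Bochner_Integration.integrable_bound[of M "\<lambda>x. 1 + X x ^ 4"])
  show "AE x in M. norm (X x ^ k) \<le> norm (1 + X x ^ 4)"
    using abs_power_le_one_plus_fourth[OF \<open>k \<le> 4\<close>]
    by (intro AE_I2) (simp add: order_trans[OF _ abs_ge_self])
qed (use assms in auto)

lemma integrable_fourth_power_add: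
  fixes X Y :: "'a \<Rightarrow> real"
  assumes [measurable]: "X \<in> borel_measurable M" "Y \<in> borel_measurable M"
    and int: "integrable M (\<lambda>x. X x ^ 4)" "integrable M (\<lambda>x. Y x ^ 4)"
  shows "integrable M (\<lambda>x. (X x + Y x) ^ 4)"
proof (rule Bochner_Integration.integrable_bound[of M "\<lambda>x. 8 * (X x ^ 4 + Y x ^ 4)"])
  show "AE x in M. norm ((X x + Y x) ^ 4) \<le> norm (8 * (X x ^ 4 + Y x ^ 4))"
    using fourth_power_sum_le[of "X x" "Y x" for x] by (intro AE_I2) simp
qed (use int in auto)

text \<open>
  When the fourth power of the sum is expanded, centring and independence kill every term in which some
  variable occurs exactly once. Only the \<open>X\<^sub>i\<^sup>4\<close> and the \<open>X\<^sub>i\<^sup>2 * X\<^sub>j\<^sup>2\<close> survive, so the growth is quadratic in the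
  number of summands and not quartic. The induction adds one variable at a time and therefore has to
  carry the first and second moments along.
\<close>

lemma indep_sum_moments:
  fixes X :: "'i \<Rightarrow> 'a \<Rightarrow> real"
  assumes "finite I" and "indep_vars (\<lambda>_. borel) X I"
    and "\<And>i. i \<in> I \<Longrightarrow> integrable M (\<lambda>x. X i x ^ 4)"
    and "\<And>i. i \<in> I \<Longrightarrow> expectation (X i) = 0"
    and "\<And>i. i \<in> I \<Longrightarrow> expectation (\<lambda>x. X i x ^ 2) \<le> B"
    and "\<And>i. i \<in> I \<Longrightarrow> expectation (\<lambda>x. X i x ^ 4) \<le> B"
    and "B \<ge> 0"
  shows "integrable M (\<lambda>x. (\<Sum>i\<in>I. X i x) ^ 4) \<and>
    expectation (\<lambda>x. \<Sum>i\<in>I. X i x) = 0 \<and>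
    expectation (\<lambda>x. (\<Sum>i\<in>I. X i x) ^ 2) \<le> B * card I \<and>
    expectation (\<lambda>x. (\<Sum>i\<in>I. X i x) ^ 4) \<le> (B + 3 * B ^ 2) * (card I) ^ 2"
  using assms(1-6)
proof (induction I rule: finite_induct)
  case empty
  then show ?case by simp
next
  case (insert j I)
  define S where "S = (\<lambda>x. \<Sum>i\<in>I. X i x)"
  define Y where "Y = X j"
  have ind: "indep_var borel Y borel S"
    unfolding Y_def S_def using insert by (intro indep_vars_sum) auto
  then have meas[measurable]: "Y \<in> borel_measurable M" "S \<in> borel_measurable M"
    by (auto dest: indep_var_rv1 indep_var_rv2)
  have IH: "integrable M (\<lambda>x. S x ^ 4)" "expectation S = 0"
    "expectation (\<lambda>x. S x ^ 2) \<le> B * card I"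
    "expectation (\<lambda>x. S x ^ 4) \<le> (B + 3 * B ^ 2) * (card I) ^ 2"
    using insert.IH indep_vars_subset[OF insert.prems(1), of I] insert.prems unfolding S_def by auto
  have Y: "integrable M (\<lambda>x. Y x ^ 4)" "expectation Y = 0" "expectation (\<lambda>x. Y x ^ 2) \<le> B"
    "expectation (\<lambda>x. Y x ^ 4) \<le> B"
    using insert.prems unfolding Y_def by auto
  have iY: "integrable M (\<lambda>x. Y x ^ k)" and iS: "integrable M (\<lambda>x. S x ^ k)" if "k \<le> 4" for k
    using that IH Y by (auto intro: integrable_power_of_fourth)
  have ind': "indep_var borel (\<lambda>x. Y x ^ k) borel (\<lambda>x. S x ^ l)" for k l
    using indep_var_compose[OF ind, of "\<lambda>x. x ^ k" borel "\<lambda>x. x ^ l" borel] by (simp add: comp_def)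
  have prod: "integrable M (\<lambda>x. Y x ^ k * S x ^ l)"
    "expectation (\<lambda>x. Y x ^ k * S x ^ l) = expectation (\<lambda>x. Y x ^ k) * expectation (\<lambda>x. S x ^ l)"
    if "k \<le> 4" "l \<le> 4" for k l
    using that ind' iY iS by (auto intro!: indep_var_integrable indep_var_lebesgue_integral)
  have sum: "(\<Sum>i\<in>insert j I. X i x) = Y x + S x" for x
    using insert by (simp add: Y_def S_def)
  have i4: "integrable M (\<lambda>x. (Y x + S x) ^ 4)"
    using IH Y by (intro integrable_fourth_power_add) auto
  have e1: "expectation (\<lambda>x. Y x + S x) = 0"
    using iY[of 1] iS[of 1] IH Y by simp
  have "expectation (\<lambda>x. (Y x + S x) ^ 2)
      = expectation (\<lambda>x. Y x ^ 2 + S x ^ 2 + 2 * (Y x ^ 1 * S x ^ 1))"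
    by (simp add: power2_eq_square algebra_simps)
  also have "\<dots> = expectation (\<lambda>x. Y x ^ 2) + expectation (\<lambda>x. S x ^ 2)"
    using iY[of 2] iS[of 2] prod[of 1 1] IH Y by simp
  finally have e2: "expectation (\<lambda>x. (Y x + S x) ^ 2) \<le> B * card (insert j I)"
    using IH(3) Y(3) insert(1,2) by (simp add: algebra_simps)
  have "expectation (\<lambda>x. (Y x + S x) ^ 4)
      = expectation (\<lambda>x. Y x ^ 4 + S x ^ 4 + 4 * (Y x ^ 3 * S x ^ 1) + 4 * (Y x ^ 1 * S x ^ 3)
          + 6 * (Y x ^ 2 * S x ^ 2))"
    by (intro Bochner_Integration.integral_cong refl) (simp add: eval_nat_numeral algebra_simps)
  also have "\<dots> = expectation (\<lambda>x. Y x ^ 4) + expectation (\<lambda>x. S x ^ 4)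
      + 6 * (expectation (\<lambda>x. Y x ^ 2) * expectation (\<lambda>x. S x ^ 2))"
    using iY[of 4] iS[of 4] prod[of 3 1] prod[of 1 3] prod[of 2 2] IH(2) Y(2) by simp
  also have "\<dots> \<le> B + (B + 3 * B ^ 2) * (card I) ^ 2 + 6 * (B * (B * card I))"
    using IH Y \<open>B \<ge> 0\<close> by (intro add_mono mult_left_mono mult_mono) auto
  also have "\<dots> \<le> (B + 3 * B ^ 2) * (card (insert j I)) ^ 2"
    using insert(1,2) \<open>B \<ge> 0\<close> by (simp add: power2_eq_square algebra_simps)
  finally have e4: "expectation (\<lambda>x. (Y x + S x) ^ 4) \<le> (B + 3 * B ^ 2) * (card (insert j I)) ^ 2" .
  show ?case unfolding sum using i4 e1 e2 e4 by blast
qed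

text \<open>
  Markov's inequality for the fourth power of the centred sum. With \<open>n\<close> summands the sum has to fall
  \<open>n * \<mu> + K \<ge> min \<mu> 1 * (n + K)\<close> below its mean, so the quadratic fourth moment leaves a bound of order
  \<open>1 / (n + K)\<^sup>2\<close>. This form is chosen because the bounds for fixed \<open>K\<close> and all \<open>n\<close> are the tail of one
  convergent series and thus add up to something small when \<open>K\<close> is large.
\<close>

lemma indep_sum_left_tail:
  fixes X :: "'i \<Rightarrow> 'a \<Rightarrow> real" and K :: real
  assumes "finite I" and ind: "indep_vars (\<lambda>_. borel) X I"
    and int: "\<And>i. i \<in> I \<Longrightarrow> integrable M (\<lambda>x. X i x ^ 4)"
    and mean: "\<And>i. i \<in> I \<Longrightarrow> expectation (X i) = \<mu>"
    and fourth: "\<And>i. i \<in> I \<Longrightarrow> expectation (\<lambda>x. X i x ^ 4) \<le> B"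
    and "B \<ge> 0" "\<mu> > 0" "K > 0"
  defines "b \<equiv> 1 + 8 * (B + \<mu> ^ 4)"
  shows "\<P>(x in M. (\<Sum>i\<in>I. X i x) \<le> - K)
    \<le> (b + 3 * b ^ 2) / (min \<mu> 1) ^ 4 / (card I + K) ^ 2"
proof -
  define n where "n = real (card I)"
  define Y where "Y i x = X i x + (- \<mu>)" for i x
  have [measurable]: "X i \<in> borel_measurable M" if "i \<in> I" for i
    using ind that by (auto simp: indep_vars_def)
  have b: "b \<ge> 1" using \<open>B \<ge> 0\<close> \<open>\<mu> > 0\<close> by (simp add: b_def)
  have iX: "integrable M (X i)" if "i \<in> I" for i
    using integrable_power_of_fourth[of "X i" 1] that int by simp
  have i4: "integrable M (\<lambda>x. Y i x ^ 4)" if "i \<in> I" for i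
    unfolding Y_def using that int by (intro integrable_fourth_power_add) auto
  have e4: "expectation (\<lambda>x. Y i x ^ 4) \<le> b - 1" if "i \<in> I" for i
  proof -
    have "expectation (\<lambda>x. Y i x ^ 4) \<le> expectation (\<lambda>x. 8 * (X i x ^ 4 + \<mu> ^ 4))"
      using that i4[OF that] int fourth_power_sum_le[of "X i x" "- \<mu>" for x]
      by (intro integral_mono) (auto simp: Y_def)
    also have "\<dots> \<le> b - 1" using fourth[OF that] int[OF that] by (simp add: b_def prob_space)
    finally show ?thesis .
  qed
  have e2: "expectation (\<lambda>x. Y i x ^ 2) \<le> b" if "i \<in> I" for i
  proof -
    have m: "Y i \<in> borel_measurable M" using that unfolding Y_def by measurable
    have "expectation (\<lambda>x. Y i x ^ 2) \<le> expectation (\<lambda>x. 1 + Y i x ^ 4)"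
      using abs_power_le_one_plus_fourth[of 2 "Y i x" for x] i4[OF that]
        integrable_power_of_fourth[OF m i4[OF that], of 2]
      by (intro integral_mono) auto
    also have "\<dots> \<le> b" using e4[OF that] i4[OF that] by (simp add: prob_space)
    finally show ?thesis .
  qed
  have indY: "indep_vars (\<lambda>_. borel) Y I"
    unfolding Y_def by (rule indep_vars_compose2[OF ind]) auto
  have mom: "integrable M (\<lambda>x. (\<Sum>i\<in>I. Y i x) ^ 4)"
    "expectation (\<lambda>x. (\<Sum>i\<in>I. Y i x) ^ 4) \<le> (b + 3 * b ^ 2) * n ^ 2"
  proof -
    have m: "expectation (Y i) = 0" if "i \<in> I" for i
      using that mean[OF that] iX[OF that] by (simp add: Y_def[abs_def] prob_space)
    have e4': "expectation (\<lambda>x. Y i x ^ 4) \<le> b" if "i \<in> I" for i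
      using e4[OF that] by simp
    show "integrable M (\<lambda>x. (\<Sum>i\<in>I. Y i x) ^ 4)"
      "expectation (\<lambda>x. (\<Sum>i\<in>I. Y i x) ^ 4) \<le> (b + 3 * b ^ 2) * n ^ 2"
      using indep_sum_moments[OF \<open>finite I\<close> indY i4 m e2 e4'] b by (auto simp: n_def)
  qed
  define \<nu> where "\<nu> = min \<mu> 1"
  have \<nu>: "0 < \<nu>" "\<nu> \<le> \<mu>" "\<nu> \<le> 1" using \<open>\<mu> > 0\<close> by (auto simp: \<nu>_def)
  have n0: "n \<ge> 0" by (simp add: n_def)
  have t: "0 < \<nu> * (n + K)" using \<nu> n0 \<open>K > 0\<close> by simp
  have "\<nu> * n \<le> \<mu> * n" "\<nu> * K \<le> 1 * K"
    using \<nu> n0 \<open>K > 0\<close> by (intro mult_right_mono; simp)+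
  then have le: "\<nu> * (n + K) \<le> n * \<mu> + K" by (simp add: algebra_simps)
  have "\<P>(x in M. (\<Sum>i\<in>I. X i x) \<le> - K)
      \<le> \<P>(x in M. (\<Sum>i\<in>I. Y i x) ^ 4 \<ge> (\<nu> * (n + K)) ^ 4)"
  proof (rule finite_measure_mono)
    show "{x \<in> space M. (\<Sum>i\<in>I. X i x) \<le> - K}
        \<subseteq> {x \<in> space M. (\<Sum>i\<in>I. Y i x) ^ 4 \<ge> (\<nu> * (n + K)) ^ 4}"
    proof safe
      fix x assume "(\<Sum>i\<in>I. X i x) \<le> - K"
      then have "\<nu> * (n + K) \<le> - (\<Sum>i\<in>I. Y i x)"
        using le by (simp add: Y_def sum_subtractf n_def)
      then have "(\<nu> * (n + K)) ^ 4 \<le> (- (\<Sum>i\<in>I. Y i x)) ^ 4"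
        using t by (intro power_mono) auto
      then show "(\<nu> * (n + K)) ^ 4 \<le> (\<Sum>i\<in>I. Y i x) ^ 4" by simp
    qed
    show "{x \<in> space M. (\<Sum>i\<in>I. Y i x) ^ 4 \<ge> (\<nu> * (n + K)) ^ 4} \<in> events"
      using borel_measurable_integrable[OF mom(1)] by measurable
  qed
  also have "\<dots> \<le> expectation (\<lambda>x. (\<Sum>i\<in>I. Y i x) ^ 4) / (\<nu> * (n + K)) ^ 4"
    using mom(1) t by (intro integral_Markov_inequality_measure[where A="{}"]) auto
  also have "\<dots> \<le> (b + 3 * b ^ 2) * (n + K) ^ 2 / (\<nu> * (n + K)) ^ 4"
  proof (rule divide_right_mono)
    have "(b + 3 * b ^ 2) * n ^ 2 \<le> (b + 3 * b ^ 2) * (n + K) ^ 2"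
      using b n0 \<open>K > 0\<close> by (intro mult_left_mono power_mono) auto
    then show "expectation (\<lambda>x. (\<Sum>i\<in>I. Y i x) ^ 4) \<le> (b + 3 * b ^ 2) * (n + K) ^ 2"
      using mom(2) by simp
  qed (use t in simp)
  also have "\<dots> = (b + 3 * b ^ 2) / \<nu> ^ 4 / (n + K) ^ 2"
  proof -
    have "c * m ^ 2 / (\<nu> * m) ^ 4 = c / \<nu> ^ 4 / m ^ 2" if "m > 0" for c m :: real
      using \<nu>(1) that by (simp add: power_mult_distrib eval_nat_numeral field_simps)
    from this[of "n + K" "b + 3 * b ^ 2"] show ?thesis using n0 \<open>K > 0\<close> by simp
  qed
  finally show ?thesis by (simp add: \<nu>_def n_def)
qed

end

section \<open>The network as a function of independent discrete variables\<close>

text \<open>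
  A tuple \<open>x\<close> lists values of the random inputs, with \<open>(Inl i, n)\<close> as the index of \<open>A\<^sub>i(n)\<close> and \<open>(Inr i, n)\<close> as
  that of \<open>W\<^sub>i(n)\<close>. The coordinate maps have the type of a network on the sample space of all tuples, so that
  \<open>aloha_queue\<close> itself can be evaluated on a tuple.
\<close>

definition arrival :: "nat \<Rightarrow> nat \<Rightarrow> ((nat + nat) \<times> nat \<Rightarrow> nat) \<Rightarrow> nat" where
  "arrival i n x = x (Inl i, n)"

definition transmission :: "nat \<Rightarrow> nat \<Rightarrow> ((nat + nat) \<times> nat \<Rightarrow> nat) \<Rightarrow> nat" where
  "transmission i n x = x (Inr i, n)"

lemma aloha_step_cong:
  assumes "\<And>i. i \<in> {1..M} \<Longrightarrow> a i = a' i \<and> w i = w' i \<and> Q i = Q' i" and "i \<in> {1..M}"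
  shows "aloha_step M a w Q i = aloha_step M a' w' Q' i"
  using assms unfolding aloha_step_def attempts_def by auto

lemma aloha_queue_cong:
  assumes "\<And>i m. i \<in> {1..M} \<Longrightarrow> m \<in> {1..n} \<Longrightarrow> A i m \<omega> = A' i m \<omega>' \<and> W i m \<omega> = W' i m \<omega>'"
    and "i \<in> {1..M}"
  shows "aloha_queue M A W q n \<omega> i = aloha_queue M A' W' q n \<omega>' i"
  using assms
proof (induction n arbitrary: i)
  case (Suc n)
  show ?case unfolding aloha_queue.simps by (rule aloha_step_cong) (use Suc in auto)
qed simp

context aloha_network
begin

definition primitive :: "(nat + nat) \<times> nat \<Rightarrow> 'w \<Rightarrow> nat" where
  "primitive = (\<lambda>(k, n). case k of Inl i \<Rightarrow> A i n | Inr i \<Rightarrow> W i n)"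

definition slots :: "nat set \<Rightarrow> ((nat + nat) \<times> nat) set" where
  "slots T = ({1..M} <+> {1..M}) \<times> T"

text \<open>
  For finite \<open>J\<close> the tuple takes values in a countable set, so every function of it is measurable. All
  measurability and independence in the following comes from this.
\<close>

definition observed :: "((nat + nat) \<times> nat) set \<Rightarrow> 'w \<Rightarrow> (nat + nat) \<times> nat \<Rightarrow> nat" where
  "observed J \<omega> = restrict (\<lambda>j. primitive j \<omega>) J"

lemma slots_simps [simp]:
  "(Inl i, n) \<in> slots T \<longleftrightarrow> i \<in> {1..M} \<and> n \<in> T"
  "(Inr i, n) \<in> slots T \<longleftrightarrow> i \<in> {1..M} \<and> n \<in> T"
  by (auto simp: slots_def)

lemma finite_slots [simp]: "finite T \<Longrightarrow> finite (slots T)"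
  by (simp add: slots_def)

lemma slots_mono: "S \<subseteq> T \<Longrightarrow> slots S \<subseteq> slots T"
  by (auto simp: slots_def)

lemma slots_Int: "slots S \<inter> slots T = slots (S \<inter> T)"
  by (auto simp: slots_def)

lemma slots_empty [simp]: "slots {} = {}"
  by (simp add: slots_def)

lemma indep_primitive: "indep_vars (\<lambda>_. count_space UNIV) primitive (slots {1..})"
  using indep unfolding primitive_def slots_def .

lemma arrival_observed [simp]:
  "(Inl i, n) \<in> J \<Longrightarrow> arrival i n (observed J \<omega>) = A i n \<omega>"
  by (simp add: arrival_def observed_def primitive_def)

lemma transmission_observed [simp]:
  "(Inr i, n) \<in> J \<Longrightarrow> transmission i n (observed J \<omega>) = W i n \<omega>"
  by (simp add: transmission_def observed_def primitive_def)

lemma PiM_discrete: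
  assumes "finite J"
  shows "PiM J (\<lambda>_. count_space (UNIV :: nat set)) = count_space (PiE J (\<lambda>_. UNIV))"
  using assms by (intro count_space_PiM_finite) auto

lemma measurable_primitive: "j \<in> slots {1..} \<Longrightarrow> primitive j \<in> measurable P (count_space UNIV)"
  using indep_primitive by (auto simp: indep_vars_def)

lemma measurable_observed:
  assumes "finite J" "J \<subseteq> slots {1..}"
  shows "observed J \<in> measurable P (count_space (PiE J (\<lambda>_. UNIV)))"
  unfolding PiM_discrete[OF assms(1), symmetric] observed_def
  using assms(2) by (intro measurable_restrict measurable_primitive) auto

lemma measurable_of_observed:
  assumes "finite J" "J \<subseteq> slots {1..}" "\<And>x. g x \<in> space N"
  shows "(\<lambda>\<omega>. g (observed J \<omega>)) \<in> measurable P N"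
  by (rule measurable_compose[OF measurable_observed[OF assms(1,2)]]) (use assms(3) in auto)

lemma indep_vars_of_observed:
  fixes g :: "'i \<Rightarrow> ((nat + nat) \<times> nat \<Rightarrow> nat) \<Rightarrow> real"
  assumes "\<And>l. l \<in> L \<Longrightarrow> finite (J l)" "\<And>l. l \<in> L \<Longrightarrow> J l \<subseteq> slots {1..}" "disjoint_family_on J L"
  shows "indep_vars (\<lambda>_. borel) (\<lambda>l \<omega>. g l (observed (J l) \<omega>)) L"
proof -
  have "indep_vars (\<lambda>l. PiM (J l) (\<lambda>_. count_space UNIV)) (\<lambda>l. observed (J l)) L"
    unfolding observed_def by (rule indep_vars_restrict[OF indep_primitive assms(2,3)])
  then show ?thesis
    by (rule indep_vars_compose2) (use assms(1) in \<open>auto simp: PiM_discrete\<close>)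
qed

lemma indep_var_observed:
  assumes "finite S" "finite T" "S \<subseteq> {1..}" "T \<subseteq> {1..}" "S \<inter> T = {}"
  shows "indep_var (count_space (PiE (slots S) (\<lambda>_. UNIV))) (observed (slots S))
    (count_space (PiE (slots T) (\<lambda>_. UNIV))) (observed (slots T))"
proof -
  have "indep_var (PiM (slots S) (\<lambda>_. count_space UNIV)) (observed (slots S))
      (PiM (slots T) (\<lambda>_. count_space UNIV)) (observed (slots T))"
    unfolding observed_def
    using assms by (intro indep_var_restrict[OF indep_primitive] slots_mono) (auto simp: slots_Int)
  then show ?thesis using assms by (simp add: PiM_discrete)
qed

text \<open>
  Past and future slots separate: in a probability or an integral that involves two disjoint sets of
  slots, the second set may be replaced by an independent copy. The integral version plays the role of the
  Markov property of the chain.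
\<close>

lemma prob_decouple:
  assumes "finite S" "finite T" "S \<subseteq> {1..}" "T \<subseteq> {1..}" "S \<inter> T = {}"
  shows "\<P>(\<omega> in P. F (observed (slots S) \<omega>) \<and> G (observed (slots T) \<omega>))
    = \<P>(\<omega> in P. F (observed (slots S) \<omega>)) * \<P>(\<omega> in P. G (observed (slots T) \<omega>))"
proof -
  have "indep_var (count_space UNIV) (F \<circ> observed (slots S)) (count_space UNIV) (G \<circ> observed (slots T))"
    by (rule indep_var_compose[OF indep_var_observed[OF assms]]) auto
  from prob_indep_random_variable[OF this, of "{True}" "{True}"] show ?thesis by simp
qed

lemma nn_integral_decouple:
  assumes "finite S" "finite T" "S \<subseteq> {1..}" "T \<subseteq> {1..}" "S \<inter> T = {}"
  shows "(\<integral>\<^sup>+\<omega>. f (observed (slots S) \<omega>) (observed (slots T) \<omega>) \<partial>P)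
    = (\<integral>\<^sup>+\<omega>. \<integral>\<^sup>+\<omega>'. f (observed (slots S) \<omega>) (observed (slots T) \<omega>') \<partial>P \<partial>P)"
proof -
  let ?E = "\<lambda>T. PiE (slots T) (\<lambda>_. UNIV :: nat set)"
  let ?X = "observed (slots S)" and ?Y = "observed (slots T)"
  let ?S = "count_space (?E S)" and ?T = "count_space (?E T)"
  have X: "?X \<in> measurable P ?S" and Y: "?Y \<in> measurable P ?T"
    and eq: "distr P ?S ?X \<Otimes>\<^sub>M distr P ?T ?Y = distr P (?S \<Otimes>\<^sub>M ?T) (\<lambda>\<omega>. (?X \<omega>, ?Y \<omega>))"
    using indep_var_observed[OF assms] by (auto simp: indep_var_distribution_eq)
  interpret Y: prob_space "distr P ?T ?Y" by (rule prob_space_distr) fact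
  have ctbl: "countable (?E S)" "countable (?E T)"
    using assms by (auto intro!: countable_PiE)
  have f: "case_prod f \<in> borel_measurable (?S \<Otimes>\<^sub>M ?T)"
    unfolding pair_measure_countable[OF ctbl] by simp
  have "(\<integral>\<^sup>+\<omega>. f (?X \<omega>) (?Y \<omega>) \<partial>P) = (\<integral>\<^sup>+z. case_prod f z \<partial>distr P (?S \<Otimes>\<^sub>M ?T) (\<lambda>\<omega>. (?X \<omega>, ?Y \<omega>)))"
    using X Y f by (subst nn_integral_distr) auto
  also have "\<dots> = (\<integral>\<^sup>+x. \<integral>\<^sup>+y. f x y \<partial>distr P ?T ?Y \<partial>distr P ?S ?X)"
    unfolding eq[symmetric] using f by (subst Y.nn_integral_fst[symmetric]) (auto cong: measurable_cong_sets)
  also have "\<dots> = (\<integral>\<^sup>+\<omega>. \<integral>\<^sup>+\<omega>'. f (?X \<omega>) (?Y \<omega>') \<partial>P \<partial>P)"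
    using X Y by (simp add: nn_integral_distr)
  finally show ?thesis .
qed

lemma measurable_A [measurable]: "i \<in> {1..M} \<Longrightarrow> n \<ge> 1 \<Longrightarrow> A i n \<in> measurable P (count_space UNIV)"
  using measurable_primitive[of "(Inl i, n)"] by (simp add: primitive_def)

lemma measurable_W [measurable]: "i \<in> {1..M} \<Longrightarrow> n \<ge> 1 \<Longrightarrow> W i n \<in> measurable P (count_space UNIV)"
  using measurable_primitive[of "(Inr i, n)"] by (simp add: primitive_def)

lemma
  fixes h :: "nat \<Rightarrow> real"
  assumes "i \<in> {1..M}" "n \<ge> 1"
  shows expectation_A: "expectation (\<lambda>\<omega>. h (A i n \<omega>)) = expectation (\<lambda>\<omega>. h (A i 1 \<omega>))"
    and integrable_A: "integrable P (\<lambda>\<omega>. h (A i n \<omega>)) \<longleftrightarrow> integrable P (\<lambda>\<omega>. h (A i 1 \<omega>))"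
  using assms A_ident[OF assms]
    integral_distr[of "A i n" P "count_space UNIV" h] integral_distr[of "A i 1" P "count_space UNIV" h]
    integrable_distr_eq[of "A i n" P "count_space UNIV" h]
    integrable_distr_eq[of "A i 1" P "count_space UNIV" h]
  by (auto simp: measurable_A)

lemma
  fixes h :: "nat \<Rightarrow> real"
  assumes "i \<in> {1..M}" "n \<ge> 1"
  shows expectation_W: "expectation (\<lambda>\<omega>. h (W i n \<omega>)) = expectation (\<lambda>\<omega>. h (W i 1 \<omega>))"
    and integrable_W: "integrable P (\<lambda>\<omega>. h (W i n \<omega>)) \<longleftrightarrow> integrable P (\<lambda>\<omega>. h (W i 1 \<omega>))"
  using assms W_ident[OF assms]
    integral_distr[of "W i n" P "count_space UNIV" h] integral_distr[of "W i 1" P "count_space UNIV" h]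
    integrable_distr_eq[of "W i n" P "count_space UNIV" h]
    integrable_distr_eq[of "W i 1" P "count_space UNIV" h]
  by (auto simp: measurable_W)

section \<open>Saturated service\<close>

text \<open>
  The saturated service: what user \<open>i\<close> transmits in slot \<open>n\<close> when no queue is empty and its own queue is
  at least \<open>W\<^sub>i(n)\<close>.
\<close>

definition solo :: "nat \<Rightarrow> nat \<Rightarrow> 'w \<Rightarrow> nat" where
  "solo i n \<omega> = W i n \<omega> * of_bool (\<forall>j\<in>{1..M} - {i}. W j n \<omega> = 0)"

lemma measurable_solo [measurable]:
  assumes "i \<in> {1..M}" "n \<ge> 1" shows "solo i n \<in> measurable P (count_space UNIV)"
proof -
  have *: "solo i n = (\<lambda>\<omega>. (\<lambda>x. transmission i n x * of_bool (\<forall>j\<in>{1..M} - {i}. transmission j n x = 0))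
      (observed (slots {n}) \<omega>))"
    using assms(1) by (auto simp: solo_def fun_eq_iff)
  show ?thesis unfolding * using assms(2) by (intro measurable_of_observed) (auto simp: slots_mono)
qed

lemma solo_le: "solo i n \<omega> \<le> W i n \<omega>"
  by (simp add: solo_def)

lemma integrable_solo: "i \<in> {1..M} \<Longrightarrow> n \<ge> 1 \<Longrightarrow> integrable P (\<lambda>\<omega>. real (solo i n \<omega>))"
  using integrable_W[of i n real] W_integrable[of i]
  by (intro Bochner_Integration.integrable_bound[of P "\<lambda>\<omega>. real (W i n \<omega>)" "\<lambda>\<omega>. real (solo i n \<omega>)"])
    (auto simp: solo_le)

text \<open>
  The indicator that all others are silent is a product of indicators, so the whole variable is a product
  over the users of functions of independent variables.
\<close>

lemma expectation_solo:
  assumes i: "i \<in> {1..M}" and n: "n \<ge> 1"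
  shows "expectation (\<lambda>\<omega>. real (solo i n \<omega>))
    = expectation (\<lambda>\<omega>. real (W i 1 \<omega>)) * (\<Prod>j\<in>{1..M} - {i}. 1 - \<P>(\<omega> in P. W j 1 \<omega> \<ge> 1))"
proof -
  define h :: "nat \<Rightarrow> nat \<Rightarrow> real" where "h j k = (if j = i then real k else of_bool (k = 0))" for j k
  have solo: "real (solo i n \<omega>) = (\<Prod>j\<in>{1..M}. h j (W j n \<omega>))" for \<omega>
  proof -
    have "(\<Prod>j\<in>{1..M}. h j (W j n \<omega>)) = real (W i n \<omega>) * (\<Prod>j\<in>{1..M} - {i}. of_bool (W j n \<omega> = 0))"
      using i by (subst prod.remove[of _ i]) (auto simp: h_def)
    also have "(\<Prod>j\<in>{1..M} - {i}. of_bool (W j n \<omega> = 0) :: real) = of_bool (\<forall>j\<in>{1..M} - {i}. W j n \<omega> = 0)"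
      by (cases "\<forall>j\<in>{1..M} - {i}. W j n \<omega> = 0") (auto intro!: prod.neutral)
    finally show ?thesis by (simp add: solo_def)
  qed
  have int: "integrable P (\<lambda>\<omega>. h j (W j n \<omega>))" if "j \<in> {1..M}" for j
  proof (cases "j = i")
    case True
    then show ?thesis using i n integrable_W[of i n real] W_integrable[of i] by (simp add: h_def)
  next
    case False
    then show ?thesis using that n by (intro integrable_const_bound[of _ 1]) (auto simp: h_def)
  qed
  have "indep_vars (\<lambda>_. borel) (\<lambda>j \<omega>. (\<lambda>x. h j (transmission j n x)) (observed {(Inr j, n)} \<omega>)) {1..M}"
    using n by (intro indep_vars_of_observed) (auto simp: disjoint_family_on_def)
  then have ind: "indep_vars (\<lambda>_. borel) (\<lambda>j \<omega>. h j (W j n \<omega>)) {1..M}"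
    by simp
  have "expectation (\<lambda>\<omega>. real (solo i n \<omega>)) = (\<Prod>j\<in>{1..M}. expectation (\<lambda>\<omega>. h j (W j n \<omega>)))"
    unfolding solo by (rule indep_vars_lebesgue_integral[OF _ ind int]) auto
  also have "\<dots> = expectation (\<lambda>\<omega>. real (W i 1 \<omega>)) * (\<Prod>j\<in>{1..M} - {i}. expectation (\<lambda>\<omega>. h j (W j n \<omega>)))"
    using i n expectation_W[of i n real] by (subst prod.remove[of _ i]) (auto simp: h_def)
  also have "(\<Prod>j\<in>{1..M} - {i}. expectation (\<lambda>\<omega>. h j (W j n \<omega>)))
      = (\<Prod>j\<in>{1..M} - {i}. 1 - \<P>(\<omega> in P. W j 1 \<omega> \<ge> 1))"
  proof (intro prod.cong refl)
    fix j assume j: "j \<in> {1..M} - {i}"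
    have [measurable]: "W j 1 \<in> measurable P (count_space UNIV)" using j by (intro measurable_W) auto
    define E where "E = {\<omega> \<in> space P. W j 1 \<omega> \<ge> 1}"
    have E1: "E \<in> events" unfolding E_def by measurable
    then have E2: "integrable P (indicat_real E)"
      by (auto intro!: integrable_real_indicator simp: less_top[symmetric])
    have "expectation (\<lambda>\<omega>. h j (W j n \<omega>)) = expectation (\<lambda>\<omega>. h j (W j 1 \<omega>))"
      using j n by (intro expectation_W) auto
    also have "\<dots> = expectation (\<lambda>\<omega>. 1 - indicator E \<omega>)"
      using j by (intro Bochner_Integration.integral_cong refl) (auto simp: h_def E_def indicator_def)
    also have "\<dots> = 1 - prob E"
      using E1 E2 by (simp add: prob_space)
    finally show "expectation (\<lambda>\<omega>. h j (W j n \<omega>)) = 1 - \<P>(\<omega> in P. W j 1 \<omega> \<ge> 1)"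
      unfolding E_def .
  qed
  finally show ?thesis .
qed

section \<open>The return time to the origin\<close>

abbreviation queue :: "nat \<Rightarrow> 'w \<Rightarrow> nat \<Rightarrow> nat" where
  "queue \<equiv> aloha_queue M A W (\<lambda>_. 0)"

text \<open>
  The queue lengths of the users \<open>1..M\<close> at time \<open>n\<close> are functions of the inputs of the slots up to \<open>n\<close>. Other
  indices have to be excluded, because there \<open>aloha_queue\<close> depends on inputs that need not be random
  variables.
\<close>

lemma queue_observed:
  assumes "i \<in> {1..M}" "{1..n} \<subseteq> T"
  shows "queue n \<omega> i = aloha_queue M arrival transmission (\<lambda>_. 0) n (observed (slots T) \<omega>) i"
  using assms by (intro aloha_queue_cong) (auto simp: subset_iff)

lemma measurable_queue [measurable]:
  assumes "i \<in> {1..M}"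
  shows "(\<lambda>\<omega>. queue n \<omega> i) \<in> measurable P (count_space UNIV)"
proof -
  have *: "(\<lambda>\<omega>. queue n \<omega> i)
      = (\<lambda>\<omega>. (\<lambda>x. aloha_queue M arrival transmission (\<lambda>_. 0) n x i) (observed (slots {1..n}) \<omega>))"
    using assms queue_observed by auto
  show ?thesis unfolding * by (intro measurable_of_observed) (auto simp: slots_mono)
qed

definition away :: "nat \<Rightarrow> 'w set" where
  "away n = {\<omega> \<in> space P. \<forall>k\<in>{1..n}. \<exists>i\<in>{1..M}. queue k \<omega> i \<noteq> 0}"

lemma measurable_away [measurable]: "away n \<in> events"
  unfolding away_def by measurable

lemma return_time_gt: "{\<omega> \<in> space P. enat n < aloha_return_time M A W \<omega>} = away n"
proof -
  have "enat n < aloha_return_time M A W \<omega> \<longleftrightarrow> (\<forall>k\<in>{1..n}. \<exists>i\<in>{1..M}. queue k \<omega> i \<noteq> 0)" for \<omega>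
  proof -
    have "enat n < aloha_return_time M A W \<omega> \<longleftrightarrow> enat (Suc n) \<le> aloha_return_time M A W \<omega>"
      by (simp add: Suc_ile_eq)
    also have "\<dots> \<longleftrightarrow> (\<forall>k\<ge>1. (\<forall>i\<in>{1..M}. queue k \<omega> i = 0) \<longrightarrow> Suc n \<le> k)"
      unfolding aloha_return_time_def le_Inf_iff by auto
    also have "\<dots> \<longleftrightarrow> (\<forall>k\<in>{1..n}. \<not> (\<forall>i\<in>{1..M}. queue k \<omega> i = 0))"
      by (metis atLeastAtMost_iff not_less_eq_eq)
    also have "\<dots> \<longleftrightarrow> (\<forall>k\<in>{1..n}. \<exists>i\<in>{1..M}. queue k \<omega> i \<noteq> 0)"
      by simp
    finally show ?thesis .
  qed
  then show ?thesis by (simp add: away_def)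
qed

lemma return_time_eq_infinity: "{\<omega> \<in> space P. aloha_return_time M A W \<omega> = \<infinity>} = (\<Inter>n. away n)"
proof -
  have "x = \<infinity> \<longleftrightarrow> (\<forall>n. enat n < x)" for x by (cases x) auto
  then show ?thesis unfolding return_time_gt[symmetric] by auto
qed

lemma measurable_return_time [measurable]:
  "aloha_return_time M A W \<in> measurable P (count_space UNIV)"
proof -
  have "aloha_return_time M A W -` {x} \<inter> space P \<in> events" for x
  proof (cases x)
    case (enat n)
    have *: "y = enat (Suc m) \<longleftrightarrow> enat m < y \<and> \<not> enat (Suc m) < y" for y m by (cases y) auto
    have "aloha_return_time M A W -` {x} \<inter> space P
        = {\<omega> \<in> space P. n = 0 \<or> enat (n - 1) < aloha_return_time M A W \<omega>}
          - {\<omega> \<in> space P. enat n < aloha_return_time M A W \<omega>}"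
      by (cases n) (auto simp: enat * zero_enat_def[symmetric])
    also have "\<dots> \<in> events"
      using measurable_away by (cases "n = 0") (auto simp: return_time_gt)
    finally show ?thesis .
  next
    case infinity
    have "aloha_return_time M A W -` {\<infinity>} \<inter> space P = {\<omega> \<in> space P. aloha_return_time M A W \<omega> = \<infinity>}"
      by auto
    then show ?thesis by (simp add: infinity return_time_eq_infinity)
  qed
  then show ?thesis by (subst measurable_count_space_eq2_countable) auto
qed

section \<open>Positive recurrence\<close>

text \<open>
  The Lyapunov function. For \<open>0\<close>-\<open>1\<close> valued \<open>W\<^sub>i\<close> it is the mean time to serve all packets present if only one
  queue is served at a time, each at its saturated rate.
\<close>

definition drain_time :: "(nat \<Rightarrow> nat) \<Rightarrow> real" where
  "drain_time q = (\<Sum>i\<in>{1..M}. real (q i) / expectation (\<lambda>\<omega>. real (solo i 1 \<omega>)))"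

lemma drain_time_cong: "(\<And>i. i \<in> {1..M} \<Longrightarrow> q i = q' i) \<Longrightarrow> drain_time q = drain_time q'"
  by (simp add: drain_time_def)

text \<open>
  Foster's drift condition outside the origin. Since \<open>W\<^sub>i\<close> is at most \<open>1\<close>, a nonempty queue can use all of
  its saturated service, so its term falls by at least \<open>1\<close> in mean; at least one queue is nonempty. The
  integral is the nonnegative one, in the form in which the drift is later summed along the path.
\<close>

lemma drain_time_drift:
  assumes binary: "\<And>i. i \<in> {1..M} \<Longrightarrow> AE \<omega> in P. W i n \<omega> \<in> {0, 1}"
    and pos: "\<And>i. i \<in> {1..M} \<Longrightarrow> expectation (\<lambda>\<omega>. real (solo i 1 \<omega>)) > 0"
    and nonzero: "\<exists>i\<in>{1..M}. q i \<noteq> 0"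
    and n: "n \<ge> 1"
    and load: "(\<Sum>i\<in>{1..M}. expectation (\<lambda>\<omega>. real (A i 1 \<omega>)) / expectation (\<lambda>\<omega>. real (solo i 1 \<omega>)))
      \<le> 1 - \<epsilon>" "\<epsilon> \<ge> 0"
  shows "(\<integral>\<^sup>+\<omega>. drain_time (aloha_step M (\<lambda>i. A i n \<omega>) (\<lambda>i. W i n \<omega>) q) \<partial>P) + \<epsilon> \<le> drain_time q"
proof -
  define c where "c i = expectation (\<lambda>\<omega>. real (solo i 1 \<omega>))" for i
  define V where "V \<omega> =
    (\<Sum>i\<in>{1..M}. (real (q i) + real (A i n \<omega>) - of_bool (q i \<ge> 1) * real (solo i n \<omega>)) / c i)" for \<omega>
  let ?step = "\<lambda>\<omega>. aloha_step M (\<lambda>i. A i n \<omega>) (\<lambda>i. W i n \<omega>) q"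
  have c: "c i > 0" if "i \<in> {1..M}" for i using pos that by (simp add: c_def)
  have "AE \<omega> in P. \<forall>i\<in>{1..M}. W i n \<omega> \<in> {0, 1}"
    using binary by (intro AE_finite_allI) auto
  then have le: "AE \<omega> in P. 0 \<le> drain_time (?step \<omega>) \<and> drain_time (?step \<omega>) \<le> V \<omega>"
  proof eventually_elim
    fix \<omega> assume bin: "\<forall>i\<in>{1..M}. W i n \<omega> \<in> {0, 1}"
    have "real (?step \<omega> i) \<le> real (q i) + real (A i n \<omega>) - of_bool (q i \<ge> 1) * real (solo i n \<omega>)"
      if i: "i \<in> {1..M}" for i
    proof (cases "q i \<ge> 1 \<and> solo i n \<omega> \<noteq> 0")
      case True
      then have "W i n \<omega> = 1" "\<forall>j\<in>{1..M} - {i}. W j n \<omega> = 0"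
        using bspec[OF bin i] by (auto simp: solo_def split: if_splits)
      then show ?thesis using True by (auto simp: aloha_step_def attempts_def solo_def of_nat_diff)
    next
      case False
      then show ?thesis by (auto simp: aloha_step_def)
    qed
    then have "drain_time (?step \<omega>) \<le> V \<omega>"
      unfolding drain_time_def V_def c_def[symmetric]
      by (intro sum_mono divide_right_mono less_imp_le[OF c])
    moreover have "0 \<le> drain_time (?step \<omega>)"
      unfolding drain_time_def c_def[symmetric]
      using c by (intro sum_nonneg divide_nonneg_pos) auto
    ultimately show "0 \<le> drain_time (?step \<omega>) \<and> drain_time (?step \<omega>) \<le> V \<omega>" by simp
  qed
  have iA: "integrable P (\<lambda>\<omega>. real (A i n \<omega>))" "integrable P (\<lambda>\<omega>. real (solo i n \<omega>))"
    "expectation (\<lambda>\<omega>. real (A i n \<omega>)) = expectation (\<lambda>\<omega>. real (A i 1 \<omega>))"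
    "expectation (\<lambda>\<omega>. real (solo i n \<omega>)) = c i" if "i \<in> {1..M}" for i
    using that n integrable_A[of i n real] expectation_A[of i n real] A_integrable[of i]
      integrable_solo[of i n] expectation_solo[of i n] expectation_solo[of i 1]
    by (auto simp: c_def)
  have iV: "integrable P V" unfolding V_def
    using iA by (intro Bochner_Integration.integrable_sum integrable_divide integrable_diff integrable_add
        integrable_mult_right) auto
  have "expectation V
      = (\<Sum>i\<in>{1..M}. (real (q i) + expectation (\<lambda>\<omega>. real (A i 1 \<omega>)) - of_bool (q i \<ge> 1) * c i) / c i)"
    unfolding V_def using iA by (subst Bochner_Integration.integral_sum) (auto simp: prob_space intro!: sum.cong)
  also have "\<dots> = (\<Sum>i\<in>{1..M}. real (q i) / c i + expectation (\<lambda>\<omega>. real (A i 1 \<omega>)) / c i - of_bool (q i \<ge> 1))"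
    using c by (intro sum.cong refl) (force simp: field_simps)
  also have "\<dots> = drain_time q + (\<Sum>i\<in>{1..M}. expectation (\<lambda>\<omega>. real (A i 1 \<omega>)) / c i)
      - (\<Sum>i\<in>{1..M}. of_bool (q i \<ge> 1))"
    by (simp add: sum.distrib sum_subtractf drain_time_def c_def)
  also have "\<dots> \<le> drain_time q - \<epsilon>"
  proof -
    obtain k where k: "k \<in> {1..M}" "q k \<noteq> 0" using nonzero by blast
    have "(\<Sum>i\<in>{k}. of_bool (q i \<ge> 1)) \<le> (\<Sum>i\<in>{1..M}. of_bool (q i \<ge> 1) :: real)"
      using k by (intro sum_mono2) auto
    with k load show ?thesis by (simp add: c_def)
  qed
  finally have EV: "expectation V \<le> drain_time q - \<epsilon>" .
  have V0: "expectation V \<ge> 0" using le by (intro integral_nonneg_AE) (auto elim: eventually_mono)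
  have "(\<integral>\<^sup>+\<omega>. drain_time (?step \<omega>) \<partial>P) \<le> (\<integral>\<^sup>+\<omega>. V \<omega> \<partial>P)"
  proof (rule nn_integral_mono_AE)
    show "AE \<omega> in P. ennreal (drain_time (?step \<omega>)) \<le> ennreal (V \<omega>)"
      using le by eventually_elim (simp add: ennreal_leI)
  qed
  also have "\<dots> = ennreal (expectation V)"
    using le by (intro nn_integral_eq_integral iV) (auto elim: eventually_mono)
  finally have "(\<integral>\<^sup>+\<omega>. drain_time (?step \<omega>) \<partial>P) + \<epsilon> \<le> ennreal (expectation V) + \<epsilon>"
    by (intro add_mono) auto
  also have "\<dots> = ennreal (expectation V + \<epsilon>)" using V0 load(2) by simp
  also have "\<dots> \<le> drain_time q" using EV by (intro ennreal_leI) simp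
  finally show ?thesis .
qed

lemma away_Suc_subset: "away (Suc n) \<subseteq> away n"
  by (auto simp: away_def)

text \<open>
  The drift inequality, restricted to the event that the chain has not yet returned and summed over time,
  bounds \<open>\<Sum>n\<ge>1. \<P>(T > n)\<close> by a multiple of the mean of the Lyapunov function at time \<open>1\<close>. Time \<open>0\<close> is left
  out because the chain starts at the origin, where there is no negative drift.
\<close>

lemma positive_recurrence:
  assumes binary: "\<And>i n. i \<in> {1..M} \<Longrightarrow> n \<ge> 1 \<Longrightarrow> AE \<omega> in P. W i n \<omega> \<in> {0, 1}"
    and pos: "\<And>i. i \<in> {1..M} \<Longrightarrow> expectation (\<lambda>\<omega>. real (solo i 1 \<omega>)) > 0"
    and load: "(\<Sum>i\<in>{1..M}. expectation (\<lambda>\<omega>. real (A i 1 \<omega>)) / expectation (\<lambda>\<omega>. real (solo i 1 \<omega>))) < 1"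
  shows "aloha_positive_recurrent P M A W"
proof -
  define \<epsilon> where "\<epsilon> = 1 -
    (\<Sum>i\<in>{1..M}. expectation (\<lambda>\<omega>. real (A i 1 \<omega>)) / expectation (\<lambda>\<omega>. real (solo i 1 \<omega>)))"
  have \<epsilon>: "\<epsilon> > 0" using load by (simp add: \<epsilon>_def)
  define v where "v n = (\<integral>\<^sup>+\<omega>. ennreal (drain_time (queue n \<omega>)) * indicator (away n) \<omega> \<partial>P)" for n
  have drift: "v (Suc n) + \<epsilon> * emeasure P (away n) \<le> v n" if n: "n \<ge> 1" for n
  proof -
    \<comment> \<open>\<open>f\<close> is the integrand as a function of the inputs up to slot \<open>n\<close> and of those in slot \<open>n + 1\<close>.\<close>
    let ?past = "observed (slots {1..n})" and ?now = "observed (slots {Suc n})"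
    let ?q = "\<lambda>k. aloha_queue M arrival transmission (\<lambda>_. 0) k"
    define R where "R h \<longleftrightarrow> (\<forall>k\<in>{1..n}. \<exists>i\<in>{1..M}. ?q k h i \<noteq> 0)" for h
    define f where "f h y = ennreal (drain_time
        (aloha_step M (\<lambda>i. arrival i (Suc n) y) (\<lambda>i. transmission i (Suc n) y) (?q n h))) * of_bool (R h)" for h y
    have q: "queue k \<omega> i = ?q k (?past \<omega>) i" if "k \<le> n" "i \<in> {1..M}" for k \<omega> i
      using that by (intro queue_observed) auto
    have R: "R (?past \<omega>) \<longleftrightarrow> \<omega> \<in> away n" if "\<omega> \<in> space P" for \<omega>
      using that q by (auto simp: R_def away_def)
    have f: "f (?past \<omega>) (?now \<omega>') = ennreal (drain_time
        (aloha_step M (\<lambda>i. A i (Suc n) \<omega>') (\<lambda>i. W i (Suc n) \<omega>') (queue n \<omega>))) * indicator (away n) \<omega>"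
      if "\<omega> \<in> space P" for \<omega> \<omega>'
    proof -
      have "drain_time (aloha_step M (\<lambda>i. arrival i (Suc n) (?now \<omega>'))
            (\<lambda>i. transmission i (Suc n) (?now \<omega>')) (?q n (?past \<omega>)))
          = drain_time (aloha_step M (\<lambda>i. A i (Suc n) \<omega>') (\<lambda>i. W i (Suc n) \<omega>') (queue n \<omega>))"
        by (intro drain_time_cong aloha_step_cong) (auto simp: q)
      then show ?thesis using R[OF that] by (simp add: f_def indicator_def)
    qed
    have inner: "(\<integral>\<^sup>+\<omega>'. f (?past \<omega>) (?now \<omega>') \<partial>P) + ennreal \<epsilon> * indicator (away n) \<omega>
        \<le> ennreal (drain_time (queue n \<omega>)) * indicator (away n) \<omega>" if \<omega>: "\<omega> \<in> space P" for \<omega>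
    proof (cases "\<omega> \<in> away n")
      case True
      then have "\<exists>i\<in>{1..M}. queue n \<omega> i \<noteq> 0" using n by (auto simp: away_def)
      then have "(\<integral>\<^sup>+\<omega>'. drain_time
            (aloha_step M (\<lambda>i. A i (Suc n) \<omega>') (\<lambda>i. W i (Suc n) \<omega>') (queue n \<omega>)) \<partial>P) + \<epsilon>
          \<le> drain_time (queue n \<omega>)"
        using \<epsilon> by (intro drain_time_drift binary pos) (auto simp: \<epsilon>_def)
      then show ?thesis unfolding f[OF \<omega>] using True by simp
    next
      case False
      then show ?thesis unfolding f[OF \<omega>] by simp
    qed
    have "v (Suc n) \<le> (\<integral>\<^sup>+\<omega>. f (?past \<omega>) (?now \<omega>) \<partial>P)"
      unfolding v_def
    proof (rule nn_integral_mono)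
      fix \<omega> assume \<omega>: "\<omega> \<in> space P"
      show "ennreal (drain_time (queue (Suc n) \<omega>)) * indicator (away (Suc n)) \<omega> \<le> f (?past \<omega>) (?now \<omega>)"
        unfolding f[OF \<omega>] using away_Suc_subset[of n] by (auto simp: indicator_def)
    qed
    also have "\<dots> = (\<integral>\<^sup>+\<omega>. \<integral>\<^sup>+\<omega>'. f (?past \<omega>) (?now \<omega>') \<partial>P \<partial>P)"
      by (rule nn_integral_decouple) auto
    finally have "v (Suc n) + \<epsilon> * emeasure P (away n)
        \<le> (\<integral>\<^sup>+\<omega>. \<integral>\<^sup>+\<omega>'. f (?past \<omega>) (?now \<omega>') \<partial>P \<partial>P) + (\<integral>\<^sup>+\<omega>. ennreal \<epsilon> * indicator (away n) \<omega> \<partial>P)"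
      by (simp add: nn_integral_cmult_indicator add_mono)
    also have "\<dots> = (\<integral>\<^sup>+\<omega>. (\<integral>\<^sup>+\<omega>'. f (?past \<omega>) (?now \<omega>') \<partial>P) + ennreal \<epsilon> * indicator (away n) \<omega> \<partial>P)"
    proof (rule nn_integral_add[symmetric])
      show "(\<lambda>\<omega>. \<integral>\<^sup>+\<omega>'. f (?past \<omega>) (?now \<omega>') \<partial>P) \<in> borel_measurable P"
        by (rule measurable_of_observed[where g="\<lambda>h. \<integral>\<^sup>+\<omega>'. f h (?now \<omega>') \<partial>P"]) (auto simp: slots_mono)
    qed measurable
    also have "\<dots> \<le> v n"
      unfolding v_def by (intro nn_integral_mono inner)
    finally show ?thesis .
  qed
  have tele: "v (Suc n) + (\<Sum>k\<in>{1..n}. \<epsilon> * emeasure P (away k)) \<le> v 1" for n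
  proof (induction n)
    case (Suc n)
    have "v (Suc (Suc n)) + (\<Sum>k\<in>{1..Suc n}. \<epsilon> * emeasure P (away k))
        = (v (Suc (Suc n)) + \<epsilon> * emeasure P (away (Suc n))) + (\<Sum>k\<in>{1..n}. \<epsilon> * emeasure P (away k))"
      by (simp add: ac_simps)
    also have "\<dots> \<le> v (Suc n) + (\<Sum>k\<in>{1..n}. \<epsilon> * emeasure P (away k))"
      by (intro add_mono drift) auto
    also note Suc.IH
    finally show ?case .
  qed simp
  \<comment> \<open>Starting from empty queues, the queues after one slot are just the arrivals of that slot.\<close>
  have first: "drain_time (queue 1 \<omega>) = drain_time (\<lambda>i. A i 1 \<omega>)" for \<omega>
    by (rule drain_time_cong) (simp add: aloha_step_def)
  have "v 1 \<le> (\<integral>\<^sup>+\<omega>. drain_time (\<lambda>i. A i 1 \<omega>) \<partial>P)"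
    unfolding v_def first by (intro nn_integral_mono) (auto simp: indicator_def)
  also have "\<dots> < \<infinity>"
  proof -
    have "integrable P (\<lambda>\<omega>. drain_time (\<lambda>i. A i 1 \<omega>))"
      unfolding drain_time_def using A_integrable by auto
    moreover have "drain_time q \<ge> 0" for q
      unfolding drain_time_def by (intro sum_nonneg divide_nonneg_nonneg) auto
    ultimately show ?thesis by (subst nn_integral_eq_integral) auto
  qed
  finally have v1: "v 1 < \<infinity>" .
  have "\<epsilon> * (\<Sum>t. emeasure P (away t)) = (\<Sum>t. \<epsilon> * emeasure P (away t))"
    by (rule ennreal_suminf_cmult[symmetric])
  also have "\<dots> \<le> \<epsilon> * emeasure P (away 0) + v 1"
  proof (rule suminf_le_const)
    fix n
    have "(\<Sum>t<n. \<epsilon> * emeasure P (away t)) \<le> (\<Sum>t\<in>insert 0 {1..n}. \<epsilon> * emeasure P (away t))"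
      by (intro sum_mono2) auto
    also have "\<dots> = \<epsilon> * emeasure P (away 0) + (\<Sum>t\<in>{1..n}. \<epsilon> * emeasure P (away t))"
      by (rule sum.insert) auto
    also have "\<dots> \<le> \<epsilon> * emeasure P (away 0) + v 1"
    proof (rule add_left_mono)
      show "(\<Sum>t\<in>{1..n}. \<epsilon> * emeasure P (away t)) \<le> v 1"
        by (rule order_trans[OF _ tele[of n]]) (rule add_increasing; simp)
    qed
    finally show "(\<Sum>t<n. \<epsilon> * emeasure P (away t)) \<le> \<epsilon> * emeasure P (away 0) + v 1" .
  qed auto
  also have "\<dots> < \<infinity>" using v1 by (simp add: ennreal_mult_less_top emeasure_eq_measure)
  finally have "(\<Sum>t. emeasure P (away t)) < \<infinity>"
    using \<epsilon> by (auto simp: ennreal_mult_less_top)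
  then show ?thesis
    unfolding aloha_positive_recurrent_def
    by (subst nn_integral_enat_function) (auto simp: return_time_gt measurable_return_time)
qed

section \<open>Transience\<close>

text \<open>
  The step of the random walk that lies below queue \<open>i\<close> as long as no queue is empty.
\<close>

definition net_gain :: "nat \<Rightarrow> nat \<Rightarrow> 'w \<Rightarrow> real" where
  "net_gain i n \<omega> = real (A i n \<omega>) - real (solo i n \<omega>)"

definition net_gain_of :: "nat \<Rightarrow> nat \<Rightarrow> ((nat + nat) \<times> nat \<Rightarrow> nat) \<Rightarrow> real" where
  "net_gain_of i n x = real (arrival i n x)
     - real (transmission i n x * of_bool (\<forall>j\<in>{1..M} - {i}. transmission j n x = 0))"

lemma net_gain_observed:
  "i \<in> {1..M} \<Longrightarrow> n \<in> T \<Longrightarrow> net_gain_of i n (observed (slots T) \<omega>) = net_gain i n \<omega>"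
  by (simp add: net_gain_of_def net_gain_def solo_def)

lemma measurable_net_gain [measurable]:
  "i \<in> {1..M} \<Longrightarrow> n \<ge> 1 \<Longrightarrow> net_gain i n \<in> borel_measurable P"
  unfolding net_gain_def by measurable

lemma indep_net_gain:
  assumes "i \<in> {1..M}"
  shows "indep_vars (\<lambda>_. borel) (net_gain i) {1..}"
proof -
  have "indep_vars (\<lambda>_. borel) (\<lambda>n \<omega>. net_gain_of i n (observed (slots {n}) \<omega>)) {1..}"
    by (intro indep_vars_of_observed) (auto simp: disjoint_family_on_def slots_Int slots_mono)
  then show ?thesis using assms by (simp add: net_gain_observed)
qed

text \<open>
  While all queues are nonempty, a user is served only if all others have transmission variable \<open>0\<close>, so the
  service is at most the saturated one. Positivity of the walks and nonemptiness of the queues support each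
  other in the induction. The first slot is separate: all queues are empty then, and nothing is served.
\<close>

lemma queue_ge_net_gain:
  assumes pos: "\<And>i n. i \<in> {1..M} \<Longrightarrow> n \<ge> 1 \<Longrightarrow> (\<Sum>m\<in>{1..n}. net_gain i m \<omega>) > 0"
    and "i \<in> {1..M}"
  shows "real (queue n \<omega> i) \<ge> (\<Sum>m\<in>{1..n}. net_gain i m \<omega>)"
  using assms(2)
proof (induction n arbitrary: i)
  case (Suc n)
  have "real (queue (Suc n) \<omega> i) \<ge> real (queue n \<omega> i) + net_gain i (Suc n) \<omega>"
  proof (cases "n = 0")
    case True
    then show ?thesis by (simp add: aloha_step_def net_gain_def)
  next
    case False
    have nonempty: "queue n \<omega> j \<ge> 1" if "j \<in> {1..M}" for j
      using Suc.IH[OF that] pos[OF that, of n] False by linarith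
    have "attempts (queue n \<omega>) (\<lambda>i. W i (Suc n) \<omega>) j \<longleftrightarrow> W j (Suc n) \<omega> \<noteq> 0" if "j \<in> {1..M}" for j
      using nonempty[OF that] by (auto simp: attempts_def)
    then have "min (queue n \<omega> i) (W i (Suc n) \<omega>) * of_bool (attempts (queue n \<omega>) (\<lambda>i. W i (Suc n) \<omega>) i \<and>
        (\<forall>j\<in>{1..M} - {i}. \<not> attempts (queue n \<omega>) (\<lambda>i. W i (Suc n) \<omega>) j)) \<le> solo i (Suc n) \<omega>"
      by (auto simp: solo_def)
    then show ?thesis unfolding net_gain_def aloha_queue.simps aloha_step_def by linarith
  qed
  with Suc.IH[OF Suc.prems] show ?case by simp
qed simp

lemma no_return:
  assumes pos: "\<And>i n. i \<in> {1..M} \<Longrightarrow> n \<ge> 1 \<Longrightarrow> (\<Sum>m\<in>{1..n}. net_gain i m \<omega>) > 0"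
    and "\<omega> \<in> space P"
  shows "\<omega> \<in> away n"
proof -
  have 1: "1 \<in> {1..M}" using M_ge_1 by simp
  have "queue k \<omega> 1 \<noteq> 0" if "k \<ge> 1" for k
    using queue_ge_net_gain[OF pos 1, of k] pos[OF 1 that] by auto
  with 1 \<open>\<omega> \<in> space P\<close> show ?thesis by (auto simp: away_def intro!: bexI[of _ 1])
qed

text \<open>
  With at least two users, the outcome in which all inputs of the slot equal \<open>1\<close> does it: everybody
  collides, and every user still receives a packet. A single user never collides; here a positive
  mean and integer values force a gain of at least \<open>1\<close> with positive probability.
\<close>

lemma prob_all_gain_pos:
  assumes n: "n \<ge> 1"
    and mean: "\<And>i. i \<in> {1..M} \<Longrightarrow> expectation (net_gain i n) > 0"
  shows "\<P>(\<omega> in P. \<forall>i\<in>{1..M}. net_gain i n \<omega> \<ge> 1) > 0"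
proof (cases "M = 1")
  case True
  have 1: "1 \<in> {1..M}" using M_ge_1 by simp
  have [measurable]: "net_gain 1 n \<in> borel_measurable P" using n 1 by measurable
  have "prob {\<omega> \<in> space P. net_gain 1 n \<omega> \<ge> 1} \<noteq> 0"
  proof
    assume 0: "prob {\<omega> \<in> space P. net_gain 1 n \<omega> \<ge> 1} = 0"
    have "{\<omega> \<in> space P. net_gain 1 n \<omega> \<ge> 1} \<in> events" by measurable
    with 0 have "AE \<omega> in P. \<not> net_gain 1 n \<omega> \<ge> 1"
      by (intro prob_Collect_eq_0[THEN iffD1])
    then have "AE \<omega> in P. net_gain 1 n \<omega> \<le> 0"
      by eventually_elim (simp add: net_gain_def)
    then have "expectation (net_gain 1 n) \<le> 0"
      using integral_mono_AE'[of P "\<lambda>_. 0" "net_gain 1 n"] by simp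
    then show False using mean[OF 1] by simp
  qed
  moreover have "(\<forall>i\<in>{1..M}. net_gain i n \<omega> \<ge> 1) \<longleftrightarrow> net_gain 1 n \<omega> \<ge> 1" for \<omega>
    using True by auto
  ultimately show ?thesis by (simp add: zero_less_measure_iff)
next
  case False
  define E where "E = (\<Inter>j\<in>slots {n}. primitive j -` {1} \<inter> space P)"
  have "slots {n} \<noteq> {}" using M_ge_1 by (auto simp: slots_def)
  then have "prob E = (\<Prod>j\<in>slots {n}. prob (primitive j -` {1} \<inter> space P))"
    unfolding E_def using n by (intro indep_varsD[OF indep_primitive]) (auto simp: slots_mono)
  also have "\<dots> > 0"
  proof (rule prod_pos, clarify)
    fix k m assume "(k, m) \<in> slots {n}"
    then consider i where "i \<in> {1..M}" "k = Inl i" "m = n" | i where "i \<in> {1..M}" "k = Inr i" "m = n"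
      by (auto simp: slots_def)
    then show "prob (primitive (k, m) -` {1} \<inter> space P) > 0"
    proof cases
      case 1
      have "prob (A i n -` {1} \<inter> space P) = measure (distr P (count_space UNIV) (A i n)) {1}"
        using 1 n by (subst measure_distr) auto
      also have "\<dots> = prob (A i 1 -` {1} \<inter> space P)"
        unfolding A_ident[OF 1(1) n] using 1 by (subst measure_distr) auto
      also have "A i 1 -` {1} \<inter> space P = {\<omega> \<in> space P. A i 1 \<omega> = 1}" by auto
      finally show ?thesis using A_one_pos[OF 1(1)] 1 by (simp add: primitive_def)
    next
      case 2
      have "prob (W i n -` {1} \<inter> space P) = measure (distr P (count_space UNIV) (W i n)) {1}"
        using 2 n by (subst measure_distr) auto
      also have "\<dots> = prob (W i 1 -` {1} \<inter> space P)"
        unfolding W_ident[OF 2(1) n] using 2 by (subst measure_distr) auto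
      also have "W i 1 -` {1} \<inter> space P = {\<omega> \<in> space P. W i 1 \<omega> = 1}" by auto
      finally show ?thesis using W_one_pos[OF 2(1)] 2 by (simp add: primitive_def)
    qed
  qed
  also have "prob E \<le> \<P>(\<omega> in P. \<forall>i\<in>{1..M}. net_gain i n \<omega> \<ge> 1)"
  proof (rule finite_measure_mono)
    show "E \<subseteq> {\<omega> \<in> space P. \<forall>i\<in>{1..M}. net_gain i n \<omega> \<ge> 1}"
    proof
      fix \<omega> assume \<omega>: "\<omega> \<in> E"
      have one: "A i n \<omega> = 1" "W i n \<omega> = 1" if "i \<in> {1..M}" for i
      proof -
        have "(Inl i, n) \<in> slots {n}" "(Inr i, n) \<in> slots {n}" using that by simp_all
        then have "primitive (Inl i, n) \<omega> = 1" "primitive (Inr i, n) \<omega> = 1"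
          using \<omega> unfolding E_def by blast+
        then show "A i n \<omega> = 1" "W i n \<omega> = 1" by (simp_all add: primitive_def)
      qed
      have "net_gain i n \<omega> \<ge> 1" if i: "i \<in> {1..M}" for i
      proof -
        define j where "j = (if i = 1 then 2 else 1 :: nat)"
        have "j \<in> {1..M} - {i}" using False M_ge_1 i by (auto simp: j_def)
        then have "solo i n \<omega> = 0" using one(2)[of j] by (auto simp: solo_def)
        then show ?thesis using one(1)[OF i] by (simp add: net_gain_def)
      qed
      moreover have "\<omega> \<in> space P" using \<omega> \<open>slots {n} \<noteq> {}\<close> by (auto simp: E_def)
      ultimately show "\<omega> \<in> {\<omega> \<in> space P. \<forall>i\<in>{1..M}. net_gain i n \<omega> \<ge> 1}" by blast
    qed
    show "{\<omega> \<in> space P. \<forall>i\<in>{1..M}. net_gain i n \<omega> \<ge> 1} \<in> events"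
      using n by measurable
  qed
  finally show ?thesis .
qed

lemma prob_good_start:
  assumes K: "K \<ge> 1"
    and mean: "\<And>i n. i \<in> {1..M} \<Longrightarrow> n \<ge> 1 \<Longrightarrow> expectation (net_gain i n) > 0"
  shows "\<P>(\<omega> in P. \<forall>n\<in>{1..K}. \<forall>i\<in>{1..M}. net_gain i n \<omega> \<ge> 1) > 0"
proof -
  define Y :: "nat \<Rightarrow> 'w \<Rightarrow> real" where "Y n \<omega> = of_bool (\<forall>i\<in>{1..M}. net_gain i n \<omega> \<ge> 1)" for n \<omega>
  have "indep_vars (\<lambda>_. borel)
      (\<lambda>n \<omega>. (\<lambda>x. of_bool (\<forall>i\<in>{1..M}. net_gain_of i n x \<ge> 1) :: real) (observed (slots {n}) \<omega>)) {1..K}"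
    by (intro indep_vars_of_observed) (auto simp: disjoint_family_on_def slots_Int slots_mono)
  then have ind: "indep_vars (\<lambda>_. borel) Y {1..K}"
    by (simp add: net_gain_observed Y_def[abs_def])
  have Y: "Y n -` {1} \<inter> space P = {\<omega> \<in> space P. \<forall>i\<in>{1..M}. net_gain i n \<omega> \<ge> 1}" for n
    by (auto simp: Y_def)
  have "{\<omega> \<in> space P. \<forall>n\<in>{1..K}. \<forall>i\<in>{1..M}. net_gain i n \<omega> \<ge> 1} = (\<Inter>n\<in>{1..K}. Y n -` {1} \<inter> space P)"
    unfolding Y using K by auto
  also have "prob \<dots> = (\<Prod>n\<in>{1..K}. prob (Y n -` {1} \<inter> space P))"
    using K by (intro indep_varsD[OF ind]) auto
  also have "\<dots> > 0"
    unfolding Y by (intro prod_pos prob_all_gain_pos mean) auto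
  finally show ?thesis .
qed

text \<open>
  A good start raises every walk to at least \<open>K\<close> in \<open>K\<close> slots. A walk can then become nonpositive only if
  it loses \<open>K\<close> or more in the slots after \<open>K\<close>, which is independent of the start and has total probability less
  than \<open>1\<close> for large \<open>K\<close>. Thus the start has positive probability, and only part of it is lost.
\<close>

lemma transience:
  assumes A4: "\<And>i. i \<in> {1..M} \<Longrightarrow> integrable P (\<lambda>\<omega>. real (A i 1 \<omega>) ^ 4)"
    and W4: "\<And>i. i \<in> {1..M} \<Longrightarrow> integrable P (\<lambda>\<omega>. real (W i 1 \<omega>) ^ 4)"
    and mean: "\<And>i. i \<in> {1..M} \<Longrightarrow>
      expectation (\<lambda>\<omega>. real (A i 1 \<omega>)) > expectation (\<lambda>\<omega>. real (solo i 1 \<omega>))"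
  shows "aloha_transient P M A W"
proof -
  define \<mu> where "\<mu> i =
    expectation (\<lambda>\<omega>. real (A i 1 \<omega>)) - expectation (\<lambda>\<omega>. real (solo i 1 \<omega>))" for i
  have \<mu>: "\<mu> i > 0" if "i \<in> {1..M}" for i using mean[OF that] by (simp add: \<mu>_def)
  have m: "expectation (net_gain i n) = \<mu> i" if "i \<in> {1..M}" "n \<ge> 1" for i n
    using that integrable_A[of i n real] expectation_A[of i n real] A_integrable[of i]
      integrable_solo[of i n] expectation_solo[of i n] expectation_solo[of i 1]
    by (simp add: net_gain_def[abs_def] \<mu>_def)
  define B where "B i =
    8 * (expectation (\<lambda>\<omega>. real (A i 1 \<omega>) ^ 4) + expectation (\<lambda>\<omega>. real (W i 1 \<omega>) ^ 4))" for i
  have B0: "B i \<ge> 0" for i by (simp add: B_def)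
  have fourth: "integrable P (\<lambda>\<omega>. net_gain i n \<omega> ^ 4)" "expectation (\<lambda>\<omega>. net_gain i n \<omega> ^ 4) \<le> B i"
    if i: "i \<in> {1..M}" and n: "n \<ge> 1" for i n
  proof -
    have int: "integrable P (\<lambda>\<omega>. 8 * (real (A i n \<omega>) ^ 4 + real (W i n \<omega>) ^ 4))"
      using integrable_A[OF i n, of "\<lambda>k. real k ^ 4"] integrable_W[OF i n, of "\<lambda>k. real k ^ 4"] A4[OF i] W4[OF i]
      by auto
    have le: "net_gain i n \<omega> ^ 4 \<le> 8 * (real (A i n \<omega>) ^ 4 + real (W i n \<omega>) ^ 4)" for \<omega>
    proof -
      have "net_gain i n \<omega> ^ 4 \<le> 8 * (real (A i n \<omega>) ^ 4 + real (solo i n \<omega>) ^ 4)"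
        using fourth_power_sum_le[of "real (A i n \<omega>)" "- real (solo i n \<omega>)"] by (simp add: net_gain_def)
      also have "\<dots> \<le> 8 * (real (A i n \<omega>) ^ 4 + real (W i n \<omega>) ^ 4)"
        by (intro mult_left_mono add_left_mono power_mono) (auto simp: solo_le)
      finally show ?thesis .
    qed
    show 4: "integrable P (\<lambda>\<omega>. net_gain i n \<omega> ^ 4)"
      using le i n by (intro Bochner_Integration.integrable_bound[OF int]) (auto intro!: borel_measurable_power)
    have "expectation (\<lambda>\<omega>. net_gain i n \<omega> ^ 4)
        \<le> expectation (\<lambda>\<omega>. 8 * (real (A i n \<omega>) ^ 4 + real (W i n \<omega>) ^ 4))"
      using le by (intro integral_mono 4 int)
    also have "\<dots> = B i"
      using integrable_A[OF i n, of "\<lambda>k. real k ^ 4"] integrable_W[OF i n, of "\<lambda>k. real k ^ 4"] A4[OF i] W4[OF i]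
        expectation_A[OF i n, of "\<lambda>k. real k ^ 4"] expectation_W[OF i n, of "\<lambda>k. real k ^ 4"]
      by (simp add: B_def)
    finally show "expectation (\<lambda>\<omega>. net_gain i n \<omega> ^ 4) \<le> B i" .
  qed
  define b where "b i = 1 + 8 * (B i + \<mu> i ^ 4)" for i
  define c where "c i = (b i + 3 * b i ^ 2) / (min (\<mu> i) 1) ^ 4" for i
  have c0: "c i \<ge> 0" if "i \<in> {1..M}" for i
    using B0[of i] \<mu>[OF that] by (simp add: c_def b_def)
  let ?low = "\<lambda>K i n. {\<omega> \<in> space P. (\<Sum>m\<in>{K<..K+n}. net_gain i m \<omega>) \<le> - real K}"
  have tail: "prob (?low K i n) \<le> c i / real (n + K) ^ 2" if "i \<in> {1..M}" "K \<ge> 1" for K i n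
  proof -
    have "indep_vars (\<lambda>_. borel) (net_gain i) {K<..K+n}"
      by (rule indep_vars_subset[OF indep_net_gain[OF that(1)]]) auto
    from indep_sum_left_tail[OF _ this, of "\<mu> i" "B i" "real K"] show ?thesis
      using that m fourth B0 \<mu> by (simp add: c_def b_def)
  qed
  define s where "s K = (\<Sum>n. 1 / real (n + K) ^ 2)" for K
  have summ: "summable (\<lambda>n. 1 / real (n + K) ^ 2)" for K
    using inverse_power_summable[of 2, where 'a=real] summable_iff_shift[of "\<lambda>n. 1 / real n ^ 2" K]
    by (simp add: inverse_eq_divide)
  \<comment> \<open>The summand \<open>1\<close> makes the constant positive, so that \<open>1 / c'\<close> is a valid threshold for the tail.\<close>
  define c' where "c' = 1 + (\<Sum>i\<in>{1..M}. c i)"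
  have c': "c' > 0" using c0 sum_nonneg[of "{1..M}" c] by (simp add: c'_def)
  obtain K0 where K0: "\<And>K. K \<ge> K0 \<Longrightarrow> norm (s K) < 1 / c'"
    using suminf_exist_split[of "1 / c'" "\<lambda>n. 1 / real n ^ 2"] summ[of 0] c' unfolding s_def by auto
  define K where "K = max 1 K0"
  have K: "K \<ge> 1" by (simp add: K_def)
  have sK: "0 \<le> s K" "c' * s K < 1"
    using K0[of K] c' suminf_nonneg[OF summ[of K]] by (auto simp: K_def s_def field_simps)
  define G where "G = {\<omega> \<in> space P. \<forall>n\<in>{1..K}. \<forall>i\<in>{1..M}. net_gain i n \<omega> \<ge> 1}"
  have G: "G \<in> events" unfolding G_def by measurable
  have Gpos: "prob G > 0"
    unfolding G_def using K m \<mu> by (intro prob_good_start) auto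
  have low: "?low K i n \<in> events" if "i \<in> {1..M}" for i n
    using that K by measurable
  \<comment> \<open>\<open>G\<close> concerns the slots up to \<open>K\<close>, the loss event only later slots.\<close>
  have dec: "prob (G \<inter> ?low K i n) = prob G * prob (?low K i n)" if i: "i \<in> {1..M}" for i n
  proof -
    have "\<P>(\<omega> in P. (\<forall>m\<in>{1..K}. \<forall>i\<in>{1..M}. net_gain_of i m (observed (slots {1..K}) \<omega>) \<ge> 1) \<and>
        (\<Sum>m\<in>{K<..K+n}. net_gain_of i m (observed (slots {K<..K+n}) \<omega>)) \<le> - real K)
      = \<P>(\<omega> in P. \<forall>m\<in>{1..K}. \<forall>i\<in>{1..M}. net_gain_of i m (observed (slots {1..K}) \<omega>) \<ge> 1) *
        \<P>(\<omega> in P. (\<Sum>m\<in>{K<..K+n}. net_gain_of i m (observed (slots {K<..K+n}) \<omega>)) \<le> - real K)"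
      by (rule prob_decouple[where F="\<lambda>x. \<forall>m\<in>{1..K}. \<forall>i\<in>{1..M}. net_gain_of i m x \<ge> 1"
            and G="\<lambda>x. (\<Sum>m\<in>{K<..K+n}. net_gain_of i m x) \<le> - real K"]) auto
    moreover have "G \<inter> ?low K i n = {\<omega> \<in> space P. (\<forall>m\<in>{1..K}. \<forall>i\<in>{1..M}. net_gain i m \<omega> \<ge> 1) \<and>
        (\<Sum>m\<in>{K<..K+n}. net_gain i m \<omega>) \<le> - real K}" by (auto simp: G_def)
    ultimately show ?thesis using i by (simp add: net_gain_observed G_def del: atLeastAtMost_iff cong: ball_cong)
  qed
  define bad where "bad i = (\<Union>n. G \<inter> ?low K i n)" for i
  have bad: "bad i \<in> events" if "i \<in> {1..M}" for i
    unfolding bad_def using G low[OF that] by auto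
  have badle: "prob (bad i) \<le> prob G * c i * s K" if i: "i \<in> {1..M}" for i
  proof -
    have le: "prob (G \<inter> ?low K i n) \<le> prob G * c i * (1 / real (n + K) ^ 2)" for n
      unfolding dec[OF i] using tail[OF i K, of n] mult_left_mono[of _ _ "prob G"] by fastforce
    have sm: "summable (\<lambda>n. prob G * c i * (1 / real (n + K) ^ 2))"
      using summ by (intro summable_mult)
    then have sm': "summable (\<lambda>n. prob (G \<inter> ?low K i n))"
      by (rule summable_comparison_test[rotated]) (use le in auto)
    have "prob (bad i) \<le> (\<Sum>n. prob (G \<inter> ?low K i n))"
      unfolding bad_def using G low[OF i] sm' by (intro finite_measure_subadditive_countably) auto
    also have "\<dots> \<le> (\<Sum>n. prob G * c i * (1 / real (n + K) ^ 2))"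
      using le sm' sm by (intro suminf_le)
    also have "\<dots> = prob G * c i * s K"
      unfolding s_def using summ by (intro suminf_mult)
    finally show ?thesis .
  qed
  have "prob (\<Union>i\<in>{1..M}. bad i) \<le> (\<Sum>i\<in>{1..M}. prob (bad i))"
    using bad by (intro finite_measure_subadditive_finite) auto
  also have "\<dots> \<le> (\<Sum>i\<in>{1..M}. prob G * c i * s K)"
    by (intro sum_mono badle)
  also have "\<dots> = prob G * ((\<Sum>i\<in>{1..M}. c i) * s K)"
    by (simp add: sum_distrib_left sum_distrib_right mult.assoc)
  also have "\<dots> < prob G * 1"
    using Gpos sK by (intro mult_strict_left_mono) (auto simp: c'_def algebra_simps)
  finally have "0 < prob G - prob (\<Union>i\<in>{1..M}. bad i)" by simp
  also have "\<dots> = prob (G - (\<Union>i\<in>{1..M}. bad i))"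
    using G bad by (intro finite_measure_Diff[symmetric]) (auto simp: bad_def)
  also have "\<dots> \<le> prob (\<Inter>n. away n)"
  proof (rule finite_measure_mono)
    show "G - (\<Union>i\<in>{1..M}. bad i) \<subseteq> (\<Inter>n. away n)"
    proof
      fix \<omega> assume \<omega>: "\<omega> \<in> G - (\<Union>i\<in>{1..M}. bad i)"
      have start: "(\<Sum>m\<in>{1..n}. net_gain i m \<omega>) \<ge> real n" if "n \<le> K" "i \<in> {1..M}" for n i
      proof -
        have "(\<Sum>m\<in>{1..n}. 1) \<le> (\<Sum>m\<in>{1..n}. net_gain i m \<omega>)"
          using \<omega> that by (intro sum_mono) (auto simp: G_def)
        then show ?thesis by simp
      qed
      have "(\<Sum>m\<in>{1..n}. net_gain i m \<omega>) > 0" if i: "i \<in> {1..M}" and n: "n \<ge> 1" for i n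
      proof (cases "n \<le> K")
        case True
        then show ?thesis using start[OF True i] n by simp
      next
        case False
        then have "{1..n} = {1..K} \<union> {K<..K + (n - K)}" by auto
        then have "(\<Sum>m\<in>{1..n}. net_gain i m \<omega>)
            = (\<Sum>m\<in>{1..K}. net_gain i m \<omega>) + (\<Sum>m\<in>{K<..K + (n - K)}. net_gain i m \<omega>)"
          by (simp only:) (subst sum.union_disjoint; auto)
        moreover have "\<omega> \<notin> ?low K i (n - K)" using \<omega> i by (auto simp: bad_def)
        then have "(\<Sum>m\<in>{K<..K + (n - K)}. net_gain i m \<omega>) > - real K"
          using \<omega> by (auto simp: G_def)
        ultimately show ?thesis using start[OF order_refl i] by simp
      qed
      then show "\<omega> \<in> (\<Inter>n. away n)" using \<omega> no_return by (auto simp: G_def)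
    qed
  qed (use measurable_away in auto)
  finally show ?thesis
    unfolding aloha_transient_def return_time_eq_infinity .
qed

end

theorem theorem1:
  fixes P :: "'w measure" and M :: nat
    and A W :: "nat \<Rightarrow> nat \<Rightarrow> 'w \<Rightarrow> nat"
    and lam C p :: "nat \<Rightarrow> real"
  assumes network: "aloha_network P M A W"
    and lam: "\<And>i. i \<in> {1..M} \<Longrightarrow> lam i = (\<integral>\<omega>. real (A i 1 \<omega>) \<partial>P)"
    and C: "\<And>i. i \<in> {1..M} \<Longrightarrow> C i = (\<integral>\<omega>. real (W i 1 \<omega>) \<partial>P)"
    and p: "\<And>i. i \<in> {1..M} \<Longrightarrow> p i = \<P>(\<omega> in P. W i 1 \<omega> \<ge> 1)"
  shows
    "((\<forall>i\<in>{1..M}. \<forall>n\<ge>1. AE \<omega> in P. W i n \<omega> \<in> {0, 1}) \<and>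
      (\<forall>i\<in>{1..M}. C i * (\<Prod>j\<in>{1..M} - {i}. 1 - p j) \<noteq> 0) \<and>
      (\<Sum>i\<in>{1..M}. lam i / (C i * (\<Prod>j\<in>{1..M} - {i}. 1 - p j))) < 1
        \<longrightarrow> aloha_positive_recurrent P M A W) \<and>
     ((\<forall>i\<in>{1..M}. integrable P (\<lambda>\<omega>. real (A i 1 \<omega>) ^ 4)) \<and>
      (\<forall>i\<in>{1..M}. integrable P (\<lambda>\<omega>. real (W i 1 \<omega>) ^ 4)) \<and>
      (\<forall>i\<in>{1..M}. lam i > C i * (\<Prod>j\<in>{1..M} - {i}. 1 - p j))
        \<longrightarrow> aloha_transient P M A W)"
proof -
  interpret aloha_network P M A W by (rule network)
  have rate: "C i * (\<Prod>j\<in>{1..M} - {i}. 1 - p j) = expectation (\<lambda>\<omega>. real (solo i 1 \<omega>))"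
    if i: "i \<in> {1..M}" for i
  proof -
    have "(\<Prod>j\<in>{1..M} - {i}. 1 - p j) = (\<Prod>j\<in>{1..M} - {i}. 1 - \<P>(\<omega> in P. W j 1 \<omega> \<ge> 1))"
      by (intro prod.cong refl) (simp add: p)
    then show ?thesis using expectation_solo[OF i, of 1] C[OF i] by simp
  qed
  show ?thesis
  proof (intro conjI impI; elim conjE)
    assume binary: "\<forall>i\<in>{1..M}. \<forall>n\<ge>1. AE \<omega> in P. W i n \<omega> \<in> {0, 1}"
      and nz: "\<forall>i\<in>{1..M}. C i * (\<Prod>j\<in>{1..M} - {i}. 1 - p j) \<noteq> 0"
      and load: "(\<Sum>i\<in>{1..M}. lam i / (C i * (\<Prod>j\<in>{1..M} - {i}. 1 - p j))) < 1"
    show "aloha_positive_recurrent P M A W"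
    proof (rule positive_recurrence)
      show "AE \<omega> in P. W i n \<omega> \<in> {0, 1}" if "i \<in> {1..M}" "n \<ge> 1" for i n
        using binary that by blast
      show "expectation (\<lambda>\<omega>. real (solo i 1 \<omega>)) > 0" if "i \<in> {1..M}" for i
      proof -
        have "expectation (\<lambda>\<omega>. real (solo i 1 \<omega>)) \<noteq> 0"
          using nz that unfolding rate[OF that, symmetric] by blast
        moreover have "expectation (\<lambda>\<omega>. real (solo i 1 \<omega>)) \<ge> 0" by simp
        ultimately show ?thesis by linarith
      qed
      have "(\<Sum>i\<in>{1..M}. lam i / (C i * (\<Prod>j\<in>{1..M} - {i}. 1 - p j)))
          = (\<Sum>i\<in>{1..M}. expectation (\<lambda>\<omega>. real (A i 1 \<omega>)) / expectation (\<lambda>\<omega>. real (solo i 1 \<omega>)))"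
        by (intro sum.cong refl) (simp only: lam rate)
      with load show "(\<Sum>i\<in>{1..M}. expectation (\<lambda>\<omega>. real (A i 1 \<omega>)) / expectation (\<lambda>\<omega>. real (solo i 1 \<omega>))) < 1"
        by simp
    qed
  next
    assume A4: "\<forall>i\<in>{1..M}. integrable P (\<lambda>\<omega>. real (A i 1 \<omega>) ^ 4)"
      and W4: "\<forall>i\<in>{1..M}. integrable P (\<lambda>\<omega>. real (W i 1 \<omega>) ^ 4)"
      and fast: "\<forall>i\<in>{1..M}. lam i > C i * (\<Prod>j\<in>{1..M} - {i}. 1 - p j)"
    show "aloha_transient P M A W"
    proof (rule transience)
      show "expectation (\<lambda>\<omega>. real (solo i 1 \<omega>)) < expectation (\<lambda>\<omega>. real (A i 1 \<omega>))"
        if i: "i \<in> {1..M}" for i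
        using fast i unfolding rate[OF i, symmetric] lam[OF i, symmetric] by blast
    qed (use A4 W4 in blast)+
  qed
qed

end
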